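(* Let $\mathcal{T}$ be an essentially small triangulated category, and let $\operatorname{Esp}\mathcal{T}$ be any fixed set of thick subcategories of $\mathcal{T}$ (whose elements are called prime thick subcategories). Then there is a one-to-one correspondence between $\operatorname{Rad}\mathcal{T}$ and $\operatorname{Param}\mathcal{T}$: the maps $$\operatorname{Rad}\mathcal{T}\to\operatorname{Param}\mathcal{T},\ \mathcal{X}\mapsto\operatorname{Spp}\mathcal{X},\qquad \operatorname{Param}\mathcal{T}\to\operatorname{Rad}\mathcal{T},\ S\mapsto\operatorname{Spp}^{-1}S$$ are well defined and mutually inverse bijections.
   Context: $\operatorname{Th}\mathcal{T}$ is the set of thick subcategories of $\mathcal{T}$ (full triangulated subcategories closed under direct summands), and $\operatorname{Esp}\mathcal{T}\subseteq\operatorname{Th}\mathcal{T}$ is a fixed subset. For an object $M\in\mathcal{T}$ put $\operatorname{Spp}M=\{\mathcal{P}\in\operatorname{Esp}\mathcal{T}\mid M\notin\mathcal{P}\}$, and for a thick subcategory $\mathcal{X}$ put $\operatorname{Spp}\mathcal{X}=\bigcup_{M\in\mathcal{X}}\operatorname{Spp}M=\{\mathcal{P}\in\operatorname{Esp}\mathcal{T}\mid\mathcal{X}\nsubseteq\mathcal{P}\}$. For $S\subseteq\operatorname{Esp}\mathcal{T}$ put $\operatorname{Spp}^{-1}S=\{M\in\mathcal{T}\mid\operatorname{Spp}M\subseteq S\}$. The radical of a thick subcategory $\mathcal{X}$ is $\sqrt{\mathcal{X}}=\bigcap_{\mathcal{P}\in\operatorname{Esp}\mathcal{T},\ \mathcal{X}\subseteq\mathcal{P}}\mathcal{P}$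 (an empty intersection being $\mathcal{T}$); $\mathcal{X}$ is radical if $\sqrt{\mathcal{X}}=\mathcal{X}$, and $\operatorname{Rad}\mathcal{T}$ is the set of radical thick subcategories of $\mathcal{T}$. Finally $\operatorname{Param}\mathcal{T}=\{\operatorname{Spp}\mathcal{X}\mid\mathcal{X}\in\operatorname{Th}\mathcal{T}\}$. *)

theory Defs
  imports "HOL-Algebra.Group"
begin

section \<open>Additive categories\<close>

text \<open>
  A category has a set of objects and a set of arrows, inside two arbitrary HOL types.
  Since HOL has no proper classes, every such category is small; so an essentially small
  category is just a category in this sense, and its thick subcategories form a set.
  The operations are only constrained on the carriers.
\<close>

record ('o, 'm) precat =
  Obj :: "'o set"
  Arr :: "'m set"
  Dom :: "'m \<Rightarrow> 'o"
  Cod :: "'m \<Rightarrow> 'o"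
  Ident :: "'o \<Rightarrow> 'm"
  Comp :: "'m \<Rightarrow> 'm \<Rightarrow> 'm"  (infixl "\<cdot>\<index>" 70)

definition Hom :: "('o, 'm, 'z) precat_scheme \<Rightarrow> 'o \<Rightarrow> 'o \<Rightarrow> 'm set" where
  "Hom C X Y = {f \<in> Arr C. Dom C f = X \<and> Cod C f = Y}"

locale category =
  fixes C :: "('o, 'm, 'z) precat_scheme" (structure)
  assumes Dom_closed: "f \<in> Arr C \<Longrightarrow> Dom C f \<in> Obj C"
    and Cod_closed: "f \<in> Arr C \<Longrightarrow> Cod C f \<in> Obj C"
    and Ident_closed: "X \<in> Obj C \<Longrightarrow> Ident C X \<in> Hom C X X"
    and Comp_closed: "\<lbrakk>f \<in> Hom C X Y; g \<in> Hom C Y Z\<rbrakk> \<Longrightarrow> g \<cdot> f \<in> Hom C X Z"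
    and Comp_Ident: "f \<in> Hom C X Y \<Longrightarrow> f \<cdot> Ident C X = f"
    and Ident_Comp: "f \<in> Hom C X Y \<Longrightarrow> Ident C Y \<cdot> f = f"
    and Comp_assoc: "\<lbrakk>f \<in> Hom C X Y; g \<in> Hom C Y Z; h \<in> Hom C Z W\<rbrakk>
                       \<Longrightarrow> h \<cdot> g \<cdot> f = h \<cdot> (g \<cdot> f)"

definition is_iso :: "('o, 'm, 'z) precat_scheme \<Rightarrow> 'o \<Rightarrow> 'o \<Rightarrow> 'm \<Rightarrow> bool" where
  "is_iso C X Y f \<longleftrightarrow> f \<in> Hom C X Y \<and>
     (\<exists>g \<in> Hom C Y X. g \<cdot>\<^bsub>C\<^esub> f = Ident C X \<and> f \<cdot>\<^bsub>C\<^esub> g = Ident C Y)"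

definition isomorphic :: "('o, 'm, 'z) precat_scheme \<Rightarrow> 'o \<Rightarrow> 'o \<Rightarrow> bool" where
  "isomorphic C X Y \<longleftrightarrow> (\<exists>f. is_iso C X Y f)"

definition zero_object :: "('o, 'm, 'z) precat_scheme \<Rightarrow> 'o \<Rightarrow> bool" where
  "zero_object C Z \<longleftrightarrow> Z \<in> Obj C \<and>
     (\<forall>X \<in> Obj C. (\<exists>!f. f \<in> Hom C X Z) \<and> (\<exists>!f. f \<in> Hom C Z X))"

record ('o, 'm) preadd = "('o, 'm) precat" +
  Plus :: "'m \<Rightarrow> 'm \<Rightarrow> 'm"
  Zero :: "'o \<Rightarrow> 'o \<Rightarrow> 'm"

text \<open>
  Multiplicative notation of \<open>HOL-Algebra\<close>: \<open>inv\<close> in \<open>Hom_group C X Y\<close> is the negation of arrows.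
\<close>

definition Hom_group :: "('o, 'm, 'z) preadd_scheme \<Rightarrow> 'o \<Rightarrow> 'o \<Rightarrow> 'm monoid" where
  "Hom_group C X Y = \<lparr>carrier = Hom C X Y, mult = Plus C, one = Zero C X Y\<rparr>"

locale preadditive_category = category C
  for C :: "('o, 'm, 'z) preadd_scheme" (structure) +
  assumes Hom_comm_group: "\<lbrakk>X \<in> Obj C; Y \<in> Obj C\<rbrakk> \<Longrightarrow> comm_group (Hom_group C X Y)"
    and Comp_Plus: "\<lbrakk>f \<in> Hom C X Y; f' \<in> Hom C X Y; g \<in> Hom C Y Z\<rbrakk>
                      \<Longrightarrow> g \<cdot> Plus C f f' = Plus C (g \<cdot> f) (g \<cdot> f')"
    and Plus_Comp: "\<lbrakk>f \<in> Hom C X Y; g \<in> Hom C Y Z; g' \<in> Hom C Y Z\<rbrakk>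
                      \<Longrightarrow> Plus C g g' \<cdot> f = Plus C (g \<cdot> f) (g' \<cdot> f)"

definition is_direct_sum :: "('o, 'm, 'z) preadd_scheme \<Rightarrow> 'o \<Rightarrow> 'o \<Rightarrow> 'o \<Rightarrow> bool" where
  "is_direct_sum C B X Y \<longleftrightarrow> B \<in> Obj C \<and> X \<in> Obj C \<and> Y \<in> Obj C \<and>
     (\<exists>i \<in> Hom C X B. \<exists>j \<in> Hom C Y B. \<exists>p \<in> Hom C B X. \<exists>q \<in> Hom C B Y.
        p \<cdot>\<^bsub>C\<^esub> i = Ident C X \<and> q \<cdot>\<^bsub>C\<^esub> j = Ident C Y \<and>
        p \<cdot>\<^bsub>C\<^esub> j = Zero C Y X \<and> q \<cdot>\<^bsub>C\<^esub> i = Zero C X Y \<and>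
        Plus C (i \<cdot>\<^bsub>C\<^esub> p) (j \<cdot>\<^bsub>C\<^esub> q) = Ident C B)"

locale additive_category = preadditive_category C
  for C :: "('o, 'm, 'z) preadd_scheme" (structure) +
  assumes ex_zero_object: "\<exists>Z. zero_object C Z"
    and ex_direct_sum: "\<lbrakk>X \<in> Obj C; Y \<in> Obj C\<rbrakk> \<Longrightarrow> \<exists>B. is_direct_sum C B X Y"


section \<open>Triangulated categories\<close>

text \<open>
  A triangle \<open>X \<rightarrow> Y \<rightarrow> Z \<rightarrow> \<Sigma>X\<close> is recorded as the triple of its three arrows;
  \<open>Sh\<close> and \<open>ShA\<close> are the shift on objects and on arrows.  The shift is only required to be
  an additive autoequivalence (fully faithful and essentially surjective), which
  includes the convention that it is an automorphism.
\<close>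

record ('o, 'm) pretri = "('o, 'm) preadd" +
  Sh :: "'o \<Rightarrow> 'o"
  ShA :: "'m \<Rightarrow> 'm"
  Dist :: "('m \<times> 'm \<times> 'm) set"

definition triangle ::
    "('o, 'm, 'z) pretri_scheme \<Rightarrow> 'o \<Rightarrow> 'o \<Rightarrow> 'o \<Rightarrow> 'm \<Rightarrow> 'm \<Rightarrow> 'm \<Rightarrow> bool" where
  "triangle C X Y Z f g h \<longleftrightarrow>
     f \<in> Hom C X Y \<and> g \<in> Hom C Y Z \<and> h \<in> Hom C Z (Sh C X)"

definition dist_triangle ::
    "('o, 'm, 'z) pretri_scheme \<Rightarrow> 'o \<Rightarrow> 'o \<Rightarrow> 'o \<Rightarrow> 'm \<Rightarrow> 'm \<Rightarrow> 'm \<Rightarrow> bool" where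
  "dist_triangle C X Y Z f g h \<longleftrightarrow> triangle C X Y Z f g h \<and> (f, g, h) \<in> Dist C"

locale triangulated_category = additive_category C
  for C :: "('o, 'm, 'z) pretri_scheme" (structure) +
  assumes Sh_closed: "X \<in> Obj C \<Longrightarrow> Sh C X \<in> Obj C"
    and ShA_Ident: "X \<in> Obj C \<Longrightarrow> ShA C (Ident C X) = Ident C (Sh C X)"
    and ShA_Comp: "\<lbrakk>f \<in> Hom C X Y; g \<in> Hom C Y Z\<rbrakk> \<Longrightarrow> ShA C (g \<cdot> f) = ShA C g \<cdot> ShA C f"
    and ShA_Plus: "\<lbrakk>f \<in> Hom C X Y; f' \<in> Hom C X Y\<rbrakk>
                     \<Longrightarrow> ShA C (Plus C f f') = Plus C (ShA C f) (ShA C f')"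
    and Sh_fully_faithful: "\<lbrakk>X \<in> Obj C; Y \<in> Obj C\<rbrakk>
                     \<Longrightarrow> bij_betw (ShA C) (Hom C X Y) (Hom C (Sh C X) (Sh C Y))"
    and Sh_ess_surj: "Y \<in> Obj C \<Longrightarrow> \<exists>X \<in> Obj C. isomorphic C (Sh C X) Y"
    and Dist_triangle: "(f, g, h) \<in> Dist C \<Longrightarrow> \<exists>X Y Z. triangle C X Y Z f g h"
    and TR1_iso: "\<lbrakk>dist_triangle C X Y Z f g h; triangle C X' Y' Z' f' g' h';
                   is_iso C X X' a; is_iso C Y Y' b; is_iso C Z Z' c;
                   b \<cdot> f = f' \<cdot> a; c \<cdot> g = g' \<cdot> b; ShA C a \<cdot> h = h' \<cdot> c\<rbrakk>
                     \<Longrightarrow> dist_triangle C X' Y' Z' f' g' h'"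
    and TR1_Ident: "\<lbrakk>X \<in> Obj C; zero_object C Z\<rbrakk>
                     \<Longrightarrow> dist_triangle C X X Z (Ident C X) (Zero C X Z) (Zero C Z (Sh C X))"
    and TR1_ex: "f \<in> Hom C X Y \<Longrightarrow> \<exists>Z g h. dist_triangle C X Y Z f g h"
    and TR2: "triangle C X Y Z f g h \<Longrightarrow>
                dist_triangle C X Y Z f g h \<longleftrightarrow>
                dist_triangle C Y Z (Sh C X) g h
                  (inv\<^bsub>Hom_group C (Sh C X) (Sh C Y)\<^esub> (ShA C f))"
    and TR3: "\<lbrakk>dist_triangle C X Y Z f g h; dist_triangle C X' Y' Z' f' g' h';
               a \<in> Hom C X X'; b \<in> Hom C Y Y'; b \<cdot> f = f' \<cdot> a\<rbrakk>
                 \<Longrightarrow> \<exists>c \<in> Hom C Z Z'. c \<cdot> g = g' \<cdot> b \<and> ShA C a \<cdot> h = h' \<cdot> c"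
    and TR4: "\<lbrakk>dist_triangle C X Y Z' f i j; dist_triangle C Y Z X' g k l;
               dist_triangle C X Z Y' (g \<cdot> f) m n\<rbrakk>
                 \<Longrightarrow> \<exists>u v. dist_triangle C Z' Y' X' u v (ShA C i \<cdot> l) \<and>
                       u \<cdot> i = m \<cdot> g \<and> n \<cdot> u = j \<and> v \<cdot> m = k \<and> l \<cdot> v = ShA C f \<cdot> n"


section \<open>Thick subcategories, supports and radicals\<close>

text \<open>
  A full subcategory is identified with its set of objects.  The three conditions on
  triangles follow from each other by rotation; the shift conditions
  say that the subcategory is stable under the shift and, up to isomorphism, its inverse.
\<close>

definition triangulated_subcategory :: "('o, 'm, 'z) pretri_scheme \<Rightarrow> 'o set \<Rightarrow> bool" where
  "triangulated_subcategory T \<X> \<longleftrightarrow>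
     \<X> \<subseteq> Obj T \<and>
     (\<forall>Z. zero_object T Z \<longrightarrow> Z \<in> \<X>) \<and>
     (\<forall>X Y. X \<in> \<X> \<and> isomorphic T X Y \<longrightarrow> Y \<in> \<X>) \<and>
     (\<forall>X \<in> Obj T. X \<in> \<X> \<longleftrightarrow> Sh T X \<in> \<X>) \<and>
     (\<forall>X Y Z f g h. dist_triangle T X Y Z f g h \<longrightarrow>
        (X \<in> \<X> \<and> Y \<in> \<X> \<longrightarrow> Z \<in> \<X>) \<and>
        (Y \<in> \<X> \<and> Z \<in> \<X> \<longrightarrow> X \<in> \<X>) \<and>
        (X \<in> \<X> \<and> Z \<in> \<X> \<longrightarrow> Y \<in> \<X>))"

definition Th :: "('o, 'm, 'z) pretri_scheme \<Rightarrow> 'o set set" where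
  "Th T = {\<X>. triangulated_subcategory T \<X> \<and>
               (\<forall>M N N'. M \<in> \<X> \<and> is_direct_sum T M N N' \<longrightarrow> N \<in> \<X>)}"

text \<open>
  \<open>E\<close> is the fixed set of prime thick subcategories.
\<close>

definition Spp_obj :: "'o set set \<Rightarrow> 'o \<Rightarrow> 'o set set" where
  "Spp_obj E M = {P \<in> E. M \<notin> P}"

definition Spp :: "'o set set \<Rightarrow> 'o set \<Rightarrow> 'o set set" where
  "Spp E \<X> = (\<Union>M \<in> \<X>. Spp_obj E M)"

definition Spp_inv :: "('o, 'm, 'z) pretri_scheme \<Rightarrow> 'o set set \<Rightarrow> 'o set set \<Rightarrow> 'o set" where
  "Spp_inv T E S = {M \<in> Obj T. Spp_obj E M \<subseteq> S}"

text \<open>Intersecting with \<open>Obj T\<close> makes the empty intersection equal to the whole category.\<close>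

definition radical :: "('o, 'm, 'z) pretri_scheme \<Rightarrow> 'o set set \<Rightarrow> 'o set \<Rightarrow> 'o set" where
  "radical T E \<X> = Obj T \<inter> \<Inter>{P \<in> E. \<X> \<subseteq> P}"

definition Rad :: "('o, 'm, 'z) pretri_scheme \<Rightarrow> 'o set set \<Rightarrow> 'o set set" where
  "Rad T E = {\<X> \<in> Th T. radical T E \<X> = \<X>}"

definition Param :: "('o, 'm, 'z) pretri_scheme \<Rightarrow> 'o set set \<Rightarrow> 'o set set set" where
  "Param T E = {Spp E \<X> | \<X>. \<X> \<in> Th T}"

end

theory Submission
  imports Defs
begin

text \<open>
  A prime \<open>P\<close> lies outside \<open>Spp E \<X>\<close> exactly when \<open>P\<close> contains \<open>\<X>\<close>.  Hence the support of
  \<open>M\<close> is contained in that of \<open>\<X>\<close> iff every prime containing \<open>\<X>\<close> contains \<open>M\<close>, so that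
  \<open>Spp_inv\<close> after \<open>Spp\<close> is the radical (\<open>Spp_inv_Spp\<close>).  Moreover \<open>\<X>\<close> and its radical are
  contained in the same primes, so they have the same support (\<open>Spp_radical\<close>) and taking
  radicals is idempotent.  Thus the two maps are the Galois connection between subcategories
  and sets of primes given by membership: its closed subcategories are the radical ones, and
  supports of arbitrary thick subcategories are already supports of radical ones.

  The triangulated structure enters only in one place: a radical has to be thick again.
  It is an intersection of thick subcategories, and thickness is a closure condition
  (\<open>Th_Obj\<close>, \<open>Th_Int_Inter\<close>).
\<close>

lemma (in category) Hom_Obj:
  assumes "f \<in> Hom C X Y"
  shows "X \<in> Obj C" "Y \<in> Obj C"
  using assms Dom_closed Cod_closed by (auto simp: Hom_def)

text \<open>The whole category is the radical of a subcategory that no prime contains.\<close>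

lemma (in triangulated_category) Th_Obj: "Obj C \<in> Th C"
proof -
  have "Y \<in> Obj C" if "isomorphic C X Y" for X Y
    using that Hom_Obj by (auto simp: isomorphic_def is_iso_def)
  moreover have "X \<in> Obj C \<and> Y \<in> Obj C \<and> Z \<in> Obj C"
    if "dist_triangle C X Y Z f g h" for X Y Z f g h
    using that Hom_Obj by (auto simp: dist_triangle_def triangle_def)
  ultimately show ?thesis
    using Sh_closed
    by (auto simp: Th_def triangulated_subcategory_def zero_object_def is_direct_sum_def)
qed

text \<open>
  Each clause of thickness is a Horn condition on membership, hence passes to
  intersections; the shift clause is an equivalence and passes as two such conditions.
\<close>

lemma Th_Int_Inter:
  assumes "\<Y> \<in> Th T" and "F \<subseteq> Th T"
  shows "\<Y> \<inter> \<Inter>F \<in> Th T"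
proof -
  define G where "G = insert \<Y> F"
  have thick: "triangulated_subcategory T A"
    and summand: "\<And>M N N'. \<lbrakk>M \<in> A; is_direct_sum T M N N'\<rbrakk> \<Longrightarrow> N \<in> A" if "A \<in> G" for A
    using that assms unfolding G_def Th_def by blast+
  have "\<Inter>G \<subseteq> Obj T"
    using thick[of \<Y>] by (auto simp: G_def triangulated_subcategory_def)
  moreover have "\<forall>Z. zero_object T Z \<longrightarrow> Z \<in> \<Inter>G"
    using thick by (simp add: triangulated_subcategory_def)
  moreover have "\<forall>X Y. X \<in> \<Inter>G \<and> isomorphic T X Y \<longrightarrow> Y \<in> \<Inter>G"
    using thick unfolding triangulated_subcategory_def by (meson Inter_iff)
  moreover have "\<forall>X \<in> Obj T. X \<in> \<Inter>G \<longleftrightarrow> Sh T X \<in> \<Inter>G"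
    using thick by (simp add: triangulated_subcategory_def)
  moreover have "(X \<in> \<Inter>G \<and> Y \<in> \<Inter>G \<longrightarrow> Z \<in> \<Inter>G) \<and>
      (Y \<in> \<Inter>G \<and> Z \<in> \<Inter>G \<longrightarrow> X \<in> \<Inter>G) \<and> (X \<in> \<Inter>G \<and> Z \<in> \<Inter>G \<longrightarrow> Y \<in> \<Inter>G)"
    if "dist_triangle T X Y Z f g h" for X Y Z f g h
  proof -
    have "(X \<in> A \<and> Y \<in> A \<longrightarrow> Z \<in> A) \<and> (Y \<in> A \<and> Z \<in> A \<longrightarrow> X \<in> A) \<and>
        (X \<in> A \<and> Z \<in> A \<longrightarrow> Y \<in> A)" if "A \<in> G" for A
      using thick[OF that] \<open>dist_triangle T X Y Z f g h\<close>
      unfolding triangulated_subcategory_def by blast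
    then show ?thesis by blast
  qed
  ultimately have "triangulated_subcategory T (\<Inter>G)"
    unfolding triangulated_subcategory_def by blast
  moreover have "\<forall>M N N'. M \<in> \<Inter>G \<and> is_direct_sum T M N N' \<longrightarrow> N \<in> \<Inter>G"
    using summand by (meson Inter_iff)
  moreover have "\<Y> \<inter> \<Inter>F = \<Inter>G"
    by (simp add: G_def)
  ultimately show ?thesis
    unfolding Th_def by simp
qed

lemma radical_in_Th:
  assumes "triangulated_category T" and "E \<subseteq> Th T"
  shows "radical T E \<X> \<in> Th T"
  unfolding radical_def
  using assms by (intro Th_Int_Inter triangulated_category.Th_Obj) auto

lemma Spp_eq: "Spp E \<X> = {P \<in> E. \<not> \<X> \<subseteq> P}"
  by (auto simp: Spp_def Spp_obj_def)

lemma Spp_inv_Spp: "Spp_inv T E (Spp E \<X>) = radical T E \<X>"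
  by (auto simp: Spp_inv_def Spp_eq Spp_obj_def radical_def)

lemma radical_subset_prime_iff:
  assumes "\<X> \<subseteq> Obj T" and "P \<in> E"
  shows "radical T E \<X> \<subseteq> P \<longleftrightarrow> \<X> \<subseteq> P"
  using assms by (auto simp: radical_def)

lemma Spp_radical:
  assumes "\<X> \<subseteq> Obj T"
  shows "Spp E (radical T E \<X>) = Spp E \<X>"
  using radical_subset_prime_iff[OF assms] by (auto simp: Spp_eq)

lemma Th_subset_Obj: "\<X> \<in> Th T \<Longrightarrow> \<X> \<subseteq> Obj T"
  by (simp add: Th_def triangulated_subcategory_def)

lemma radical_in_Rad:
  assumes "triangulated_category T" and "E \<subseteq> Th T" and "\<X> \<subseteq> Obj T"
  shows "radical T E \<X> \<in> Rad T E"
proof -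
  \<comment> \<open>The radical depends on the support alone, and the support of the radical is unchanged.\<close>
  have "radical T E (radical T E \<X>) = radical T E \<X>"
    by (metis Spp_inv_Spp Spp_radical[OF assms(3)])
  then show ?thesis
    by (simp add: Rad_def radical_in_Th[OF assms(1,2)])
qed

theorem theorem1p2:
  fixes T :: "('o, 'm, 'z) pretri_scheme" and Esp :: "'o set set"
  assumes "triangulated_category T"
    and "Esp \<subseteq> Th T"
  shows "(\<forall>\<X> \<in> Rad T Esp. Spp Esp \<X> \<in> Param T Esp) \<and>
         (\<forall>S \<in> Param T Esp. Spp_inv T Esp S \<in> Rad T Esp) \<and>
         (\<forall>\<X> \<in> Rad T Esp. Spp_inv T Esp (Spp Esp \<X>) = \<X>) \<and>
         (\<forall>S \<in> Param T Esp. Spp Esp (Spp_inv T Esp S) = S) \<and>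
         bij_betw (Spp Esp) (Rad T Esp) (Param T Esp) \<and>
         bij_betw (Spp_inv T Esp) (Param T Esp) (Rad T Esp)"
proof -
  have Spp_closed: "\<forall>\<X> \<in> Rad T Esp. Spp Esp \<X> \<in> Param T Esp"
    by (auto simp: Rad_def Param_def)
  have inv_closed: "\<forall>S \<in> Param T Esp. Spp_inv T Esp S \<in> Rad T Esp"
    using radical_in_Rad[OF assms Th_subset_Obj] by (auto simp: Param_def Spp_inv_Spp)
  have inv_Spp: "\<forall>\<X> \<in> Rad T Esp. Spp_inv T Esp (Spp Esp \<X>) = \<X>"
    by (simp add: Spp_inv_Spp Rad_def)
  have Spp_inv: "\<forall>S \<in> Param T Esp. Spp Esp (Spp_inv T Esp S) = S"
    by (auto simp: Param_def Spp_inv_Spp Spp_radical[OF Th_subset_Obj])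
  have "bij_betw (Spp Esp) (Rad T Esp) (Param T Esp)"
    using inv_Spp Spp_inv Spp_closed inv_closed
    by (intro bij_betw_byWitness[where f' = "Spp_inv T Esp"]) auto
  moreover have "bij_betw (Spp_inv T Esp) (Param T Esp) (Rad T Esp)"
    using inv_Spp Spp_inv Spp_closed inv_closed
    by (intro bij_betw_byWitness[where f' = "Spp Esp"]) auto
  ultimately show ?thesis
    using Spp_closed inv_closed inv_Spp Spp_inv by blast
qed

end
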